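(* Let $\mathfrak{p}_2(n)$ denote the number of $2$-colored partitions of $n$, i.e. $\sum_{n\ge 0}\mathfrak{p}_2(n)q^n=\prod_{m\ge1}(1-q^m)^{-2}$, with $\mathfrak{p}_2(m)=0$ for $m<0$. For $j\in\mathbb{Z}$ let $w_j=\frac{3j^2+j}{2}$ be the $j$-th pentagonal number and for $k\ge 0$ let $T_k=\frac{k^2+k}{2}$ be the $k$-th triangular number. Then for every positive integer $n$, $$ \mathfrak{p}_2(n)=\begin{cases} (-1)^j+\sum_{k\geq 1} (-1)^{k+1}(2k+1)\,\mathfrak{p}_2(n-T_k) & \text{ if } n=w_j \text{ for some } j\in\mathbb{Z},\\ \sum_{k\geq 1} (-1)^{k+1}(2k+1)\,\mathfrak{p}_2(n-T_k) & \text{ otherwise.} \end{cases} $$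
   Context: A $t$-colored partition of $n$ is a partition of $n$ in which each part may appear in one of $t$ colors. The pentagonal numbers $w_j$, $j\in\mathbb{Z}$, are pairwise distinct, so $j$ is determined by $n$ in the first case. *)

theory Defs
  imports "HOL-Analysis.Infinite_Sum" "HOL-Library.Multiset"
begin

text \<open>A part \<open>m\<close> in colour \<open>c\<close> is the pair \<open>(m, c)\<close>; the colours are \<open>0, \<dots>, t - 1\<close>.\<close>

definition colored_partitions :: "nat \<Rightarrow> nat \<Rightarrow> (nat \<times> nat) multiset set" where
  "colored_partitions t n =
     {P. (\<forall>(m, c) \<in> set_mset P. 0 < m \<and> c < t) \<and> (\<Sum>x\<in>#P. fst x) = n}"

definition num_colored_partitions :: "nat \<Rightarrow> int \<Rightarrow> nat" where
  "num_colored_partitions t n = (if n < 0 then 0 else card (colored_partitions t (nat n)))"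

abbreviation p2 :: "int \<Rightarrow> nat" where
  "p2 \<equiv> num_colored_partitions 2"

text \<open>The divisions by 2 below are exact.\<close>

definition pentagonal :: "int \<Rightarrow> int" where
  "pentagonal j = (3 * j\<^sup>2 + j) div 2"

definition triangular :: "nat \<Rightarrow> nat" where
  "triangular k = (k\<^sup>2 + k) div 2"

text \<open>The infinite sum is taken in the discrete topology of \<open>int\<close>; only finitely many terms
  are nonzero.\<close>

definition triangular_sum :: "int \<Rightarrow> int" where
  "triangular_sum n =
     (\<Sum>\<^sub>\<infinity>k\<in>{1..}. (-1) ^ (k + 1) * (2 * int k + 1) * int (p2 (n - int (triangular k))))"

end

theory Submission
  imports Defs "HOL-Computational_Algebra.Formal_Power_Series"
begin

text \<open>
  Let \<open>P = (\<Prod>m\<ge>1. 1 - q ^ m)\<close>.  The generating function of the 2-colored partitions is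
  \<open>P ^ (-2)\<close>, so its product with \<open>P ^ 3\<close> is \<open>P\<close>.  Expand \<open>P ^ 3\<close> by Jacobi's identity
  \<open>P ^ 3 = (\<Sum>k\<ge>0. (-1) ^ k * (2 * k + 1) * q ^ T k)\<close> and \<open>P\<close> by Euler's pentagonal number
  theorem, and compare coefficients of \<open>q ^ n\<close>.  Both expansions come from finite identities,
  valid modulo \<open>q ^ (n + 1)\<close> for the truncated product: Shanks' partial sums for Euler's theorem,
  and the derivative at \<open>z = 1\<close> of the finite triple product for Jacobi's.
\<close>

section \<open>Truncated Euler products and their reciprocals\<close>

definition qpoch :: "nat \<Rightarrow> 'a::field fps" where
  "qpoch n = (\<Prod>i=1..n. 1 - fps_X ^ i)"

definition inv_qpoch :: "nat \<Rightarrow> 'a::field fps" where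
  "inv_qpoch n = inverse (qpoch n)"

lemma qpoch_0 [simp]: "qpoch 0 = 1"
  by (simp add: qpoch_def)

lemma qpoch_Suc: "qpoch (Suc n) = (1 - fps_X ^ Suc n) * qpoch n"
  by (simp add: qpoch_def mult.commute)

lemma fps_nth_0_qpoch [simp]: "fps_nth (qpoch n) 0 = 1"
  by (induction n) (simp_all add: qpoch_Suc)

lemma qpoch_times_inv: "qpoch n * inv_qpoch n = 1"
  unfolding inv_qpoch_def by (subst mult.commute, rule inverse_mult_eq_1) simp

lemma inv_qpoch_0 [simp]: "inv_qpoch 0 = 1"
  by (simp add: inv_qpoch_def)

text \<open>Used to bring reciprocals of different indices to a common denominator, which leaves a
  polynomial identity.\<close>

lemma inv_qpoch_step: "inv_qpoch n = (1 - fps_X ^ Suc n) * inv_qpoch (Suc n)"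
proof -
  have "(1 - fps_X ^ Suc n) * inv_qpoch (Suc n)
      = (1 - fps_X ^ Suc n) * inv_qpoch (Suc n) * (qpoch n * inv_qpoch n)"
    by (simp only: qpoch_times_inv mult_1_right)
  also have "\<dots> = qpoch (Suc n) * inv_qpoch (Suc n) * inv_qpoch n"
    by (simp only: qpoch_Suc mult_ac)
  also have "\<dots> = inv_qpoch n"
    by (simp only: qpoch_times_inv mult_1_left)
  finally show ?thesis ..
qed

section \<open>Triangular numbers\<close>

lemma triangular_0 [simp]: "triangular 0 = 0"
  by (simp add: triangular_def)

lemma triangular_Suc [simp]: "triangular (Suc k) = triangular k + Suc k"
proof -
  have "(Suc k)\<^sup>2 + Suc k = (k\<^sup>2 + k) + Suc k * 2"
    by (simp add: power2_eq_square algebra_simps)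
  then show ?thesis
    unfolding triangular_def by simp
qed

lemma le_triangular: "k \<le> triangular k"
  by (induction k) auto

lemma twice_triangular: "2 * triangular k = k\<^sup>2 + k"
  by (induction k) (auto simp: power2_eq_square algebra_simps)

section \<open>Euler's pentagonal number theorem\<close>

definition shanks_sum :: "nat \<Rightarrow> 'a::field fps" where
  "shanks_sum n =
     (\<Sum>s\<le>n. (-1) ^ s * (qpoch n * inv_qpoch s) * fps_X ^ (s * n + triangular s))"

text \<open>With \<open>c = qpoch n\<close>, the summands are the differences between corresponding
  terms of \<open>shanks_sum (Suc n)\<close> and \<open>shanks_sum n\<close>. They telescope because
  \<open>inv_qpoch m\<close> is (1 - q^(m+1)) times \<open>inv_qpoch (Suc m)\<close>.\<close>

lemma shanks_telescope:
  "(\<Sum>s\<le>m. (-1) ^ s * (c * inv_qpoch s) *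
       (fps_X ^ (s * Suc n + triangular s) * (1 - fps_X ^ Suc n) - fps_X ^ (s * n + triangular s)))
   = - ((-1) ^ m * (c * inv_qpoch m) * fps_X ^ (Suc m * Suc n + triangular m) :: 'a::field fps)"
proof (induction m)
  case 0
  show ?case by (simp add: algebra_simps)
next
  case (Suc m)
  \<comment> \<open>All exponents become a common one plus a remainder, so the powers of q factor
    and ring arithmetic suffices.\<close>
  have e: "Suc m * Suc n + triangular m = Suc m * n + triangular (Suc m)"
    by simp
  have e2: "Suc m * Suc n + triangular (Suc m) = Suc m * n + triangular (Suc m) + Suc m"
    by simp
  have e3: "Suc (Suc m) * Suc n + triangular (Suc m)
      = Suc m * n + triangular (Suc m) + Suc m + Suc n"
    by simp
  show ?case
    unfolding sum.atMost_Suc Suc.IH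
    unfolding e e2 e3 inv_qpoch_step[of m]
    unfolding power_add power_Suc[of "-1 :: 'a fps"] by (simp add: algebra_simps)
qed

text \<open>The new top term \<open>s = Suc n\<close> yields the first power; the terms common to
  both sums telescope to the second.\<close>

lemma shanks_sum_Suc:
  "shanks_sum (Suc n) = shanks_sum n + (-1) ^ Suc n *
     (fps_X ^ ((Suc n)\<^sup>2 + triangular (Suc n)) + fps_X ^ ((Suc n)\<^sup>2 + triangular n)
       :: 'a::field fps)"
proof -
  have "shanks_sum (Suc n) - shanks_sum n - (-1) ^ Suc n *
       ((qpoch (Suc n) * inv_qpoch (Suc n)) * fps_X ^ (Suc n * Suc n + triangular (Suc n)) :: 'a fps)
    = (\<Sum>s\<le>n. (-1) ^ s * (qpoch n * inv_qpoch s) * (fps_X ^ (s * Suc n + triangular s) *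
         (1 - fps_X ^ Suc n) - fps_X ^ (s * n + triangular s)))"
  proof -
    have "shanks_sum (Suc n) - shanks_sum n - (-1) ^ Suc n *
         ((qpoch (Suc n) * inv_qpoch (Suc n)) * fps_X ^ (Suc n * Suc n + triangular (Suc n)))
      = (\<Sum>s\<le>n. (-1) ^ s * (qpoch (Suc n) * inv_qpoch s) * fps_X ^ (s * Suc n + triangular s))
        - (shanks_sum n :: 'a fps)"
      unfolding shanks_sum_def sum.atMost_Suc mult.assoc by (simp only: algebra_simps)
    then show ?thesis
      unfolding shanks_sum_def qpoch_Suc sum_subtractf[symmetric]
      by (simp only: right_diff_distrib left_diff_distrib mult_ac mult_1_left mult_1_right)
  qed
  also have "\<dots> = - ((-1) ^ n * (qpoch n * inv_qpoch n) * fps_X ^ (Suc n * Suc n + triangular n))"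
    by (rule shanks_telescope)
  finally show ?thesis
    unfolding qpoch_times_inv power2_eq_square by (simp add: algebra_simps)
qed

lemma shanks_sum_eq:
  "shanks_sum n = 1 + (\<Sum>s=1..n. (-1) ^ s *
     (fps_X ^ (s\<^sup>2 + triangular s) + fps_X ^ (s\<^sup>2 + triangular (s - 1))) :: 'a::field fps)"
proof (induction n)
  case 0
  show ?case by (simp add: shanks_sum_def)
next
  case (Suc n)
  then show ?case
    by (simp only: shanks_sum_Suc) simp
qed

text \<open>The term \<open>s = 0\<close> is \<open>qpoch n\<close> itself, and every other term
  carries an exponent of at least n + 1.\<close>

lemma qpoch_shanks_sum_dvd: "fps_X ^ Suc n dvd shanks_sum n - (qpoch n :: 'a::field fps)"
proof -
  have "fps_X ^ Suc n dvd
      ((-1) ^ s * (qpoch n * inv_qpoch s) * fps_X ^ (s * n + triangular s) :: 'a fps)"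
    if s: "s \<in> {1..n}" for s
  proof (rule dvd_mult, rule le_imp_power_dvd)
    obtain r where "s = Suc r"
      using s by (cases s) auto
    then show "Suc n \<le> s * n + triangular s"
      by simp
  qed
  then have "fps_X ^ Suc n dvd
      (\<Sum>s=1..n. (-1) ^ s * (qpoch n * inv_qpoch s) * fps_X ^ (s * n + triangular s) :: 'a fps)"
    by (rule dvd_sum)
  moreover have "{..n} = insert 0 {1..n}"
    by auto
  ultimately show ?thesis
    by (simp add: shanks_sum_def)
qed

lemma fps_nth_eq_if_X_power_dvd:
  fixes f g :: "'a::comm_ring_1 fps"
  assumes "fps_X ^ Suc n dvd f - g" "i \<le> n"
  shows "fps_nth f i = fps_nth g i"
proof -
  obtain h where "f - g = fps_X ^ Suc n * h"
    using assms(1) by (elim dvdE)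
  then have "fps_nth (f - g) i = 0"
    using assms(2) by (simp only: fps_X_power_mult_nth) simp
  then show ?thesis by simp
qed

text \<open>This and the next lemma identify the two exponents in \<open>shanks_sum_eq\<close> as
  the pentagonal numbers of index s and -s.\<close>

lemma pentagonal_of_nat: "pentagonal (int s) = int (s\<^sup>2 + triangular s)"
proof -
  have "2 * int (triangular s) = (int s)\<^sup>2 + int s"
    using arg_cong[OF twice_triangular[of s], of int] by simp
  then show ?thesis
    by (simp add: pentagonal_def)
qed

lemma pentagonal_neg_of_nat:
  assumes "s > 0"
  shows "pentagonal (- int s) = int (s\<^sup>2 + triangular (s - 1))"
proof -
  obtain r where s: "s = Suc r"
    using assms by (cases s) auto
  have "2 * int (triangular s) = (int s)\<^sup>2 + int s"
    using arg_cong[OF twice_triangular[of s], of int] by simp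
  then have "2 * int (triangular (s - 1)) = (int s)\<^sup>2 - int s"
    by (simp add: s)
  then show ?thesis
    by (simp add: pentagonal_def)
qed

lemma inj_pentagonal: "inj pentagonal"
proof (rule injI)
  fix i j
  assume "pentagonal i = pentagonal j"
  moreover have "2 * pentagonal k = 3 * k\<^sup>2 + k" for k
    by (simp add: pentagonal_def)
  ultimately have "3 * i\<^sup>2 + i = 3 * j\<^sup>2 + j"
    by metis
  then have "(i - j) * (3 * (i + j) + 1) = 0"
    by (simp add: power2_eq_square algebra_simps)
  \<comment> \<open>This factor is congruent to 1 modulo 3.\<close>
  moreover have "3 * (i + j) + 1 \<noteq> 0"
    by presburger
  ultimately show "i = j"
    by simp
qed

lemma abs_le_pentagonal: "\<bar>j\<bar> \<le> pentagonal j"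
proof -
  have "\<bar>j\<bar> \<le> j\<^sup>2"
    using self_le_power[of "\<bar>j\<bar>" 2] by (cases "j = 0") auto
  then show ?thesis
    by (simp add: pentagonal_def)
qed

text \<open>Euler's theorem read off at one coefficient. Summing over all solutions j postpones the
  case distinction of the theorem; by \<open>inj_pentagonal\<close> there is at most one.\<close>

lemma fps_nth_qpoch:
  assumes "n > 0"
  shows "fps_nth (qpoch n :: 'a::field fps) n
    = (\<Sum>j | pentagonal j = int n. (-1) ^ nat \<bar>j\<bar>)"
proof -
  let ?g = "\<lambda>j. if pentagonal j = int n then (-1) ^ nat \<bar>j\<bar> else 0 :: 'a"
  \<comment> \<open>Signs become constant series so that coefficient extraction passes through
    them.\<close>
  have pow: "(-1) ^ s = (fps_const ((-1) ^ s) :: 'a fps)" for s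
    by (simp flip: fps_const_power fps_const_neg fps_const_1_eq_1)
  have "fps_nth (qpoch n) n = fps_nth (shanks_sum n :: 'a fps) n"
    by (rule fps_nth_eq_if_X_power_dvd[OF qpoch_shanks_sum_dvd order_refl, symmetric])
  also have "\<dots> = (\<Sum>s=1..n. ?g (int s) + ?g (- int s))"
    using assms unfolding shanks_sum_eq pow
    by (auto simp: fps_sum_nth pentagonal_of_nat pentagonal_neg_of_nat distrib_left
        simp del: of_nat_add of_nat_power intro!: sum.cong)
  \<comment> \<open>Positive and negative indices form disjoint images;
    \<open>abs_le_pentagonal\<close> later shows that they cover every solution.\<close>
  also have "\<dots> = (\<Sum>j\<in>int ` {1..n}. ?g j) + (\<Sum>j\<in>(\<lambda>s. - int s) ` {1..n}. ?g j)"
    by (subst (1 2) sum.reindex) (auto simp: sum.distrib inj_on_def)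
  also have "\<dots> = (\<Sum>j\<in>int ` {1..n} \<union> (\<lambda>s. - int s) ` {1..n}. ?g j)"
    by (rule sum.union_disjoint [symmetric]) auto
  also have "\<dots> = (\<Sum>j | pentagonal j = int n. (-1) ^ nat \<bar>j\<bar>)"
  proof (rule sum.mono_neutral_cong_right)
    show "{j. pentagonal j = int n} \<subseteq> int ` {1..n} \<union> (\<lambda>s. - int s) ` {1..n}"
    proof
      fix j assume "j \<in> {j. pentagonal j = int n}"
      then have j: "pentagonal j = int n" by simp
      then have "j \<noteq> 0" "\<bar>j\<bar> \<le> int n"
        using assms abs_le_pentagonal[of j] by (auto simp: pentagonal_def)
      then have "nat \<bar>j\<bar> \<in> {1..n}" "j = int (nat \<bar>j\<bar>) \<or> j = - int (nat \<bar>j\<bar>)"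
        by auto
      then show "j \<in> int ` {1..n} \<union> (\<lambda>s. - int s) ` {1..n}"
        by blast
    qed
  qed auto
  finally show ?thesis .
qed

section \<open>Jacobi's identity for the cube\<close>

text \<open>Up to sign, the coefficient of \<open>z ^ k\<close> in the finite triple product
  \<open>(\<Prod>i=0..n. 1 - q ^ i / z) * (\<Prod>i=1..n. 1 - z * q ^ i)\<close>.  Multiplying this product by
  \<open>(1 - q ^ (n + 1) / z) * (1 - z * q ^ (n + 1))\<close> gives the two recurrences below;
  the coefficients of \<open>z ^ 0\<close> and \<open>z ^ (-1)\<close> agree up to sign.\<close>

definition triple_coeff :: "nat \<Rightarrow> nat \<Rightarrow> 'a::field fps" where
  "triple_coeff n k = (if k \<le> n then
     fps_X ^ triangular k * qpoch (2 * n + 1) * inv_qpoch (n - k) * inv_qpoch (n + k + 1) else 0)"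

text \<open>The neighbour of index -1 is replaced by \<open>triple_coeff n 0\<close>, by symmetry.
  Over the common factor \<open>?U\<close> the claim is polynomial in q and a = q^n.\<close>

lemma triple_coeff_Suc_0:
  "triple_coeff (Suc n) 0 = (1 + fps_X ^ (2 * n + 2)) * triple_coeff n 0 +
     fps_X ^ Suc n * (triple_coeff n 0 + triple_coeff n 1 :: 'a::field fps)"
proof -
  let ?q = "fps_X :: 'a fps"
  let ?U = "inv_qpoch (Suc n) * inv_qpoch (n + 2) :: 'a fps"
  define a where "a = ?q ^ n"
  have a: "?q ^ Suc n = a * ?q" "?q ^ (n + 2) = a * ?q * ?q" "?q ^ (2 * n + 2) = a * a * ?q * ?q"
    "?q ^ (2 * n + 3) = a * a * ?q * ?q * ?q"
    by (simp_all add: a_def power_add mult_2 numeral_3_eq_3)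
  have u: "inv_qpoch n = (1 - a * ?q) * inv_qpoch (Suc n)"
    "inv_qpoch (n + 1) = (1 - a * ?q * ?q) * inv_qpoch (n + 2)"
    using inv_qpoch_step[of n, where 'a='a] inv_qpoch_step[of "n + 1", where 'a='a]
    unfolding a(1,2)[symmetric] by simp_all
  have P: "qpoch (2 * Suc n + 1) =
      (1 - a * a * ?q * ?q * ?q) * (1 - a * a * ?q * ?q) * qpoch (2 * n + 1)"
    unfolding a(3,4)[symmetric] by (simp add: qpoch_Suc eval_nat_numeral)
  have c0': "triple_coeff (Suc n) 0 = qpoch (2 * Suc n + 1) * ?U"
    by (simp add: triple_coeff_def mult_ac)
  have c0: "triple_coeff n 0 = qpoch (2 * n + 1) * ((1 - a * ?q) * (1 - a * ?q * ?q)) * ?U"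
    by (simp add: triple_coeff_def u[simplified])
  \<comment> \<open>For n = 0 the default value 0 of \<open>triple_coeff\<close> agrees with the
    vanishing factor 1 - a.\<close>
  have c1: "triple_coeff n 1 = ?q * qpoch (2 * n + 1) * ((1 - a) * (1 - a * ?q)) * ?U"
  proof (cases n)
    case 0
    then show ?thesis by (simp add: triple_coeff_def a_def)
  next
    case (Suc m)
    have "inv_qpoch m = (1 - a) * inv_qpoch n"
      using inv_qpoch_step[of m, where 'a='a] by (simp add: a_def Suc)
    then show ?thesis
      using u(1) by (simp add: triple_coeff_def Suc)
  qed
  show ?thesis
    unfolding c0' c0 c1 P a by (simp only: algebra_simps mult_1_left mult_1_right)
qed

lemma triple_coeff_Suc_Suc:
  "triple_coeff (Suc n) (Suc k) = (1 + fps_X ^ (2 * n + 2)) * triple_coeff n (Suc k) +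
     fps_X ^ Suc n * (triple_coeff n k + triple_coeff n (k + 2) :: 'a::field fps)"
proof -
  let ?q = "fps_X :: 'a fps"
  \<comment> \<open>Beyond the range everything is 0; at \<open>k = n\<close> only the two leading
    powers survive; otherwise m = n - k - 1 is the index of the smallest reciprocal in
    \<open>triple_coeff n (Suc k)\<close>.\<close>
  consider "n < k" | "k = n" | m where "n = Suc k + m"
    by (metis less_iff_Suc_add linorder_neqE_nat add_Suc)
  then show ?thesis
  proof cases
    case 1
    then show ?thesis by (simp add: triple_coeff_def)
  next
    case 2
    have "triple_coeff m m = ?q ^ triangular m" for m
      using qpoch_times_inv[of "2 * m + 1", where 'a='a]
      by (simp add: triple_coeff_def mult.assoc mult_2)
    moreover have "triple_coeff n (Suc n) = (0 :: 'a fps)" "triple_coeff n (n + 2) = (0 :: 'a fps)"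
      by (simp_all add: triple_coeff_def)
    ultimately show ?thesis
      by (simp add: 2 power_add)
  next
    case (3 m)
    let ?U = "inv_qpoch (Suc m) * inv_qpoch (n + k + 3) :: 'a fps"
    let ?T = "?q ^ triangular k * qpoch (2 * n + 1)"
    define a where "a = ?q ^ m"
    define b where "b = ?q ^ Suc k"
    \<comment> \<open>A equals q^(n+1), since n = k + 1 + m.\<close>
    define A where "A = a * b * ?q"
    have a: "?q ^ Suc m = a * ?q" "?q ^ Suc n = A" "?q ^ (n + k + 2) = A * b"
      "?q ^ (n + k + 3) = A * b * ?q" "?q ^ (2 * n + 2) = A * A" "?q ^ (2 * n + 3) = A * A * ?q"
      by (simp_all add: 3 A_def a_def b_def power_add mult_2 eval_nat_numeral)
    have u1: "inv_qpoch m = (1 - a * ?q) * inv_qpoch (Suc m)"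
      using inv_qpoch_step[of m, where 'a='a] unfolding a(1) .
    have u2: "inv_qpoch (n + k + 2) = (1 - A * b * ?q) * inv_qpoch (n + k + 3)"
      using inv_qpoch_step[of "n + k + 2", where 'a='a] unfolding a(4)[symmetric]
      by (simp add: eval_nat_numeral)
    have u3: "inv_qpoch (n + k + 1) = (1 - A * b) * inv_qpoch (n + k + 2)"
      using inv_qpoch_step[of "n + k + 1", where 'a='a] unfolding a(3)[symmetric] by simp
    have P: "qpoch (2 * Suc n + 1) = (1 - A * A * ?q) * (1 - A * A) * qpoch (2 * n + 1)"
      unfolding a(5,6)[symmetric] by (simp add: qpoch_Suc eval_nat_numeral)
    have T1: "?q ^ triangular (Suc k) = b * ?q ^ triangular k"
      by (simp add: b_def power_add mult_ac)
    have T2: "?q ^ triangular (k + 2) = b * b * ?q * ?q ^ triangular k"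
      by (simp add: b_def power_add mult_ac)
    have c1': "triple_coeff (Suc n) (Suc k) = b * (1 - A * A * ?q) * (1 - A * A) * ?T * ?U"
    proof -
      have "Suc n - Suc k = Suc m" "Suc n + Suc k + 1 = n + k + 3" "Suc k \<le> Suc n"
        using 3 by auto
      then show ?thesis
        unfolding triple_coeff_def T1 P by (simp only: if_True mult_ac)
    qed
    have c1: "triple_coeff n (Suc k) = b * ((1 - a * ?q) * (1 - A * b * ?q)) * ?T * ?U"
    proof -
      have "n - Suc k = m" "n + Suc k + 1 = n + k + 2" "Suc k \<le> n"
        using 3 by auto
      then show ?thesis
        unfolding triple_coeff_def T1 by (simp only: if_True u1 u2 mult_ac)
    qed
    have c0: "triple_coeff n k = (1 - A * b) * (1 - A * b * ?q) * ?T * ?U"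
    proof -
      have "n - k = Suc m" "k \<le> n"
        using 3 by auto
      then show ?thesis
        unfolding triple_coeff_def by (simp only: if_True u3 u2 mult_ac)
    qed
    have c2: "triple_coeff n (k + 2) = b * b * ?q * ((1 - a) * (1 - a * ?q)) * ?T * ?U"
    proof (cases m)
      case 0
      then show ?thesis by (simp add: triple_coeff_def a_def 3)
    next
      case (Suc l)
      have "inv_qpoch l = (1 - a) * inv_qpoch m"
        using inv_qpoch_step[of l, where 'a='a] by (simp add: a_def Suc)
      then have ul: "inv_qpoch l = (1 - a) * ((1 - a * ?q) * inv_qpoch (Suc m))"
        by (simp only: u1)
      have "n - (k + 2) = l" "n + (k + 2) + 1 = n + k + 3" "k + 2 \<le> n"
        using 3 Suc by auto
      then show ?thesis
        unfolding triple_coeff_def T2 by (simp only: if_True ul mult_ac)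
    qed
    have "b * (1 - A * A * ?q) * (1 - A * A) =
        (1 + A * A) * (b * ((1 - a * ?q) * (1 - A * b * ?q))) +
        A * ((1 - A * b) * (1 - A * b * ?q) + b * b * ?q * ((1 - a) * (1 - a * ?q)))"
      unfolding A_def by (simp only: algebra_simps mult_1_left mult_1_right)
    then show ?thesis
      unfolding c1' c1 c0 c2 a by (simp only: distrib_left distrib_right mult.assoc)
  qed
qed

text \<open>Collecting the weights of b k gives (2k - 1) + (2k + 3) = 2(2k + 1) with the opposite
  sign, so the weights are an eigenvector for eigenvalue -2, up to boundary terms.\<close>

lemma alternating_odd_sum_shift:
  fixes b c :: "nat \<Rightarrow> 'a::comm_ring_1"
  assumes "c 0 = b 0 + b 1" "\<And>k. c (Suc k) = b k + b (k + 2)"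
  shows "(\<Sum>k\<le>m. (-1) ^ k * of_nat (2 * k + 1) * c k) =
    - 2 * (\<Sum>k\<le>m. (-1) ^ k * of_nat (2 * k + 1) * b k)
    + (-1) ^ m * (of_nat (2 * m + 1) * b (m + 1) + of_nat (2 * m + 3) * b m)"
proof (induction m)
  case 0
  show ?case by (simp add: assms(1))
next
  case (Suc m)
  show ?case
    unfolding sum.atMost_Suc Suc assms(2) by (simp add: algebra_simps)
qed

text \<open>Pairing z^k with z^(-k-1) shows the left side to be the derivative of the triple product
  at z = 1. In the induction both sides gain the factor 1 - 2 q^(n+1) + q^(2n+2) = (1 - q^(n+1))^2;
  the boundary terms vanish.\<close>

lemma triple_coeff_sum:
  "(\<Sum>k\<le>n. (-1) ^ k * of_nat (2 * k + 1) * triple_coeff n k) = (qpoch n ^ 2 :: 'a::field fps)"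
proof (induction n)
  case 0
  show ?case
    using qpoch_times_inv[of 1, where 'a='a] by (simp add: triple_coeff_def)
next
  case (Suc n)
  define c where "c k = (if k = 0 then triple_coeff n 0 + triple_coeff n 1
    else triple_coeff n (k - 1) + triple_coeff n (k + 1) :: 'a fps)" for k
  define w where "w k = ((-1) ^ k * of_nat (2 * k + 1) :: 'a fps)" for k
  have rec: "triple_coeff (Suc n) k = (1 + fps_X ^ (2 * n + 2)) * triple_coeff n k +
      fps_X ^ Suc n * c k" for k
    by (cases k) (simp_all only: triple_coeff_Suc_0 triple_coeff_Suc_Suc c_def, simp_all)
  have z: "triple_coeff n (n + 1) = (0 :: 'a fps)" "triple_coeff n (n + 2) = (0 :: 'a fps)"
    by (simp_all add: triple_coeff_def)
  have S: "(\<Sum>k\<le>Suc n. w k * triple_coeff n k) = qpoch n ^ 2"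
    using Suc z(1) by (simp add: w_def)
  have "(\<Sum>k\<le>Suc n. w k * c k) = - 2 * (\<Sum>k\<le>Suc n. w k * triple_coeff n k)"
    using z unfolding w_def
    by (subst alternating_odd_sum_shift[where b = "triple_coeff n"]) (simp_all add: c_def)
  then have C: "(\<Sum>k\<le>Suc n. w k * c k) = - 2 * qpoch n ^ 2"
    by (simp only: S)
  have "(\<Sum>k\<le>Suc n. w k * triple_coeff (Suc n) k) =
      (1 + fps_X ^ (2 * n + 2)) * (\<Sum>k\<le>Suc n. w k * triple_coeff n k) +
      fps_X ^ Suc n * (\<Sum>k\<le>Suc n. w k * c k)"
    unfolding rec distrib_left sum.distrib sum_distrib_left by (simp only: mult_ac)
  also have "\<dots> = (1 - fps_X ^ Suc n)\<^sup>2 * qpoch n ^ 2"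
  proof -
    have "fps_X ^ (2 * n + 2) = ((fps_X ^ Suc n)\<^sup>2 :: 'a fps)"
      by (simp add: power2_eq_square power_add mult_2)
    then show ?thesis
      unfolding S C power2_diff by (simp only: algebra_simps power_one mult_1_left) simp
  qed
  finally show ?case
    by (simp only: w_def qpoch_Suc power_mult_distrib)
qed

text \<open>The quotient is a product of factors 1 - q^i with i > m.\<close>

lemma X_power_dvd_qpoch_quotient:
  "fps_X ^ Suc m dvd qpoch (m + l) * inv_qpoch m - (1 :: 'a::field fps)"
proof (induction l)
  case 0
  show ?case by (simp add: qpoch_times_inv)
next
  case (Suc l)
  have "qpoch (m + Suc l) * inv_qpoch m - (1 :: 'a fps) = (qpoch (m + l) * inv_qpoch m - 1)
      - fps_X ^ (Suc m + l) * (qpoch (m + l) * inv_qpoch m)"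
    by (simp add: qpoch_Suc algebra_simps)
  moreover have "fps_X ^ Suc m dvd (fps_X ^ (Suc m + l) * (qpoch (m + l) * inv_qpoch m) :: 'a fps)"
    by (rule dvd_mult2, rule le_imp_power_dvd) simp
  ultimately show ?case
    using Suc by (simp only: dvd_diff)
qed

lemma X_power_dvd_triple_coeff:
  assumes "k \<le> n"
  shows "fps_X ^ Suc n dvd qpoch n * triple_coeff n k - (fps_X ^ triangular k :: 'a::field fps)"
proof -
  let ?q = "fps_X :: 'a fps"
  define x where "x = qpoch n * (inv_qpoch (n - k) :: 'a fps)"
  define y where "y = qpoch (2 * n + 1) * (inv_qpoch (n + k + 1) :: 'a fps)"
  have "?q ^ Suc (n - k) dvd x - 1"
    using X_power_dvd_qpoch_quotient[of "n - k" k] assms by (simp add: x_def)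
  then have "?q ^ (triangular k + Suc (n - k)) dvd ?q ^ triangular k * (x - 1)"
    by (simp only: power_add mult_dvd_mono dvd_refl)
  \<comment> \<open>The quotient x is 1 only modulo q^(n-k+1); the factor q^(T_k), with T_k >= k,
    supplies the missing k.\<close>
  then have x: "?q ^ Suc n dvd ?q ^ triangular k * (x - 1)"
    by (rule power_le_dvd) (use assms le_triangular[of k] in simp)
  have "?q ^ Suc (n + k + 1) dvd y - 1"
    using X_power_dvd_qpoch_quotient[of "n + k + 1" "n - k"] assms by (simp add: y_def mult_2)
  then have y: "?q ^ Suc n dvd y - 1"
    by (rule power_le_dvd) simp
  have "qpoch n * triple_coeff n k - ?q ^ triangular k =
      ?q ^ triangular k * (x - 1) + ?q ^ triangular k * x * (y - 1)"
    using assms by (simp add: triple_coeff_def x_def y_def algebra_simps)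
  also have "?q ^ Suc n dvd \<dots>"
    by (rule dvd_add[OF x dvd_mult[OF y]])
  finally show ?thesis .
qed

text \<open>Multiply \<open>triple_coeff_sum\<close> by \<open>qpoch n\<close> and reduce each term
  modulo q^(n+1).\<close>

lemma X_power_dvd_qpoch_cube:
  "fps_X ^ Suc n dvd
     qpoch n ^ 3 - (\<Sum>k\<le>n. (-1) ^ k * of_nat (2 * k + 1) * fps_X ^ triangular k :: 'a::field fps)"
proof -
  have "qpoch n ^ 3 = qpoch n *
      (\<Sum>k\<le>n. (-1) ^ k * of_nat (2 * k + 1) * triple_coeff n k :: 'a fps)"
    unfolding triple_coeff_sum by (simp add: power3_eq_cube power2_eq_square mult.assoc)
  then have "qpoch n ^ 3 - (\<Sum>k\<le>n. (-1) ^ k * of_nat (2 * k + 1) * fps_X ^ triangular k) =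
      (\<Sum>k\<le>n. (-1) ^ k * of_nat (2 * k + 1) *
        (qpoch n * triple_coeff n k - fps_X ^ triangular k) :: 'a fps)"
    by (simp only: sum_distrib_left right_diff_distrib sum_subtractf mult_ac)
  also have "fps_X ^ Suc n dvd \<dots>"
    by (intro dvd_sum dvd_mult X_power_dvd_triple_coeff) simp
  finally show ?thesis .
qed

section \<open>The generating function of colored partitions\<close>

text \<open>Arbitrary weighted elements allow induction on the set of available coloured
  parts.\<close>

definition weighted_multisets :: "('b \<Rightarrow> nat) \<Rightarrow> 'b set \<Rightarrow> nat \<Rightarrow> 'b multiset set" where
  "weighted_multisets f S n = {P. set_mset P \<subseteq> S \<and> (\<Sum>x\<in>#P. f x) = n}"

text \<open>Removing an element strictly lowers the total weight.\<close>

lemma finite_weighted_multisets: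
  assumes "finite S" "\<And>x. x \<in> S \<Longrightarrow> f x > 0"
  shows "finite (weighted_multisets f S n)"
proof (induction n rule: less_induct)
  case (less n)
  have "weighted_multisets f S n \<subseteq>
      insert {#} (\<Union>x\<in>{x\<in>S. f x \<le> n}. add_mset x ` weighted_multisets f S (n - f x))"
  proof
    fix P assume P: "P \<in> weighted_multisets f S n"
    show "P \<in> insert {#} (\<Union>x\<in>{x\<in>S. f x \<le> n}. add_mset x ` weighted_multisets f S (n - f x))"
    proof (cases P)
      case (add x Q)
      then have "x \<in> {x\<in>S. f x \<le> n}" "Q \<in> weighted_multisets f S (n - f x)"
        using P by (auto simp: weighted_multisets_def)
      then show ?thesis
        using add by blast
    qed simp
  qed
  moreover have "finite (weighted_multisets f S (n - f x))" if "x \<in> S" "f x \<le> n" for x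
    using assms(2)[OF that(1)] that(2) by (intro less) simp
  ultimately show ?case
    using assms(1) by (elim finite_subset) auto
qed

text \<open>Either x does not occur, or one copy of it can be removed.\<close>

lemma card_weighted_multisets_insert:
  assumes "finite S" "\<And>y. y \<in> insert x S \<Longrightarrow> f y > 0" "x \<notin> S"
  shows "card (weighted_multisets f (insert x S) n) = card (weighted_multisets f S n) +
    (if n < f x then 0 else card (weighted_multisets f (insert x S) (n - f x)))"
proof -
  let ?W = "weighted_multisets f (insert x S)"
  let ?A = "if n < f x then {} else add_mset x ` ?W (n - f x)"
  have fin: "finite (?W m)" for m
    using assms by (intro finite_weighted_multisets) auto
  have "?W n = weighted_multisets f S n \<union> ?A"
  proof (intro equalityI subsetI)
    fix P assume P: "P \<in> ?W n"
    show "P \<in> weighted_multisets f S n \<union> ?A"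
    proof (cases "x \<in># P")
      case True
      then obtain Q where Q: "P = add_mset x Q"
        by (meson mset_add)
      then have "f x \<le> n" "Q \<in> ?W (n - f x)"
        using P by (auto simp: weighted_multisets_def)
      then show ?thesis
        using Q by auto
    next
      case False
      then show ?thesis
        using P by (auto simp: weighted_multisets_def)
    qed
  qed (auto simp: weighted_multisets_def split: if_splits)
  moreover have "weighted_multisets f S n \<inter> ?A = {}"
  proof -
    have "x \<notin># P" if "P \<in> weighted_multisets f S n" for P
      using that assms(3) unfolding weighted_multisets_def by blast
    moreover have "x \<in># P" if "P \<in> ?A" for P
      using that by (auto split: if_splits)
    ultimately show ?thesis
      by blast
  qed
  moreover have "finite (weighted_multisets f S n)"
    using assms by (intro finite_weighted_multisets) auto
  moreover have "card ?A = (if n < f x then 0 else card (?W (n - f x)))"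
    by (simp add: card_image inj_on_def)
  ultimately show ?thesis
    using fin by (simp add: card_Un_disjoint)
qed

text \<open>The counting recurrence says that each new element x divides the generating function by
  1 - q^(f x).\<close>

lemma weighted_multisets_gf:
  assumes "finite S" "\<And>x. x \<in> S \<Longrightarrow> f x > 0"
  shows "Abs_fps (\<lambda>n. of_nat (card (weighted_multisets f S n))) * (\<Prod>x\<in>S. 1 - fps_X ^ f x)
    = (1 :: 'a::comm_ring_1 fps)"
  using assms
proof (induction S rule: finite_induct)
  case empty
  have "weighted_multisets f {} n = (if n = 0 then {{#}} else {})" for n
    by (auto simp: weighted_multisets_def)
  then show ?case
    by (auto simp: fps_eq_iff)
next
  case (insert x S)
  let ?F = "\<lambda>S. Abs_fps (\<lambda>n. of_nat (card (weighted_multisets f S n))) :: 'a fps"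
  have "card (weighted_multisets f (insert x S) n) = card (weighted_multisets f S n) +
      (if n < f x then 0 else card (weighted_multisets f (insert x S) (n - f x)))" for n
    using insert.hyps insert.prems by (intro card_weighted_multisets_insert)
  then have "?F (insert x S) = ?F S + ?F (insert x S) * fps_X ^ f x"
    by (simp add: fps_eq_iff fps_X_power_mult_right_nth flip: of_nat_add)
  then have "?F (insert x S) * (1 - fps_X ^ f x) = ?F S"
    by (simp add: right_diff_distrib diff_eq_eq)
  then show ?case
    using insert by (simp add: mult.assoc[symmetric])
qed

text \<open>No part exceeds n, so one finite set of coloured parts serves all n up to N.\<close>

lemma colored_partitions_eq_weighted_multisets:
  assumes "n \<le> N"
  shows "colored_partitions t n = weighted_multisets fst ({1..N} \<times> {..<t}) n"
proof -
  have "fst x \<le> n" if "x \<in># P" "(\<Sum>x\<in>#P. fst x) = n" for x :: "nat \<times> nat" and P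
    using that by (auto dest!: multi_member_split)
  then show ?thesis
    using assms unfolding colored_partitions_def weighted_multisets_def
    by (fastforce simp: Suc_le_eq)
qed


section \<open>The recurrence for \<open>p2\<close>\<close>

lemma triangular_sum_eq:
  "triangular_sum (int N) =
     (\<Sum>k=1..N. (-1) ^ (k + 1) * (2 * int k + 1) * int (p2 (int N - int (triangular k))))"
proof -
  have "p2 (int N - int (triangular k)) = 0" if "N < k" for k
    using that le_triangular[of k] by (simp add: num_colored_partitions_def)
  then have "triangular_sum (int N) =
      (\<Sum>\<^sub>\<infinity>k\<in>{1..N}. (-1) ^ (k + 1) * (2 * int k + 1) * int (p2 (int N - int (triangular k))))"
    unfolding triangular_sum_def by (intro infsum_cong_neutral) auto
  then show ?thesis by simp
qed

lemma p2_convolution: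
  assumes "N > 0"
  shows "(\<Sum>k\<le>N. (-1) ^ k * (2 * int k + 1) * int (p2 (int N - int (triangular k)))) =
    (\<Sum>j | pentagonal j = int N. (-1) ^ nat \<bar>j\<bar>)"
proof -
  let ?S = "{1..N} \<times> {..<2::nat}"
  \<comment> \<open>Rational coefficients meet the field requirement of \<open>qpoch\<close>; the
    final equation returns to \<open>int\<close> by injectivity of \<open>of_int\<close>.\<close>
  define F :: "rat fps" where
    "F = Abs_fps (\<lambda>n. of_nat (card (weighted_multisets fst ?S n)))"
  define J :: "rat fps" where
    "J = (\<Sum>k\<le>N. (-1) ^ k * of_nat (2 * k + 1) * fps_X ^ triangular k)"
  have "(\<Prod>x\<in>?S. 1 - fps_X ^ fst x) = (\<Prod>m=1..N. \<Prod>c<2::nat. 1 - fps_X ^ m :: rat fps)"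
    by (simp only: prod.cartesian_product case_prod_unfold)
  then have P: "(\<Prod>x\<in>?S. 1 - fps_X ^ fst x) = (qpoch N ^ 2 :: rat fps)"
    by (simp add: qpoch_def prod_power_distrib)
  have "F * qpoch N ^ 2 = 1"
    unfolding F_def P[symmetric] by (rule weighted_multisets_gf) auto
  then have "F * qpoch N ^ 3 = qpoch N"
    by (simp add: power3_eq_cube power2_eq_square flip: mult.assoc)
  moreover have "fps_X ^ Suc N dvd F * (qpoch N ^ 3 - J)"
    unfolding J_def by (intro dvd_mult X_power_dvd_qpoch_cube)
  ultimately have "fps_X ^ Suc N dvd qpoch N - F * J"
    by (simp add: right_diff_distrib)
  then have "fps_nth (F * J) N = fps_nth (qpoch N) N"
    using fps_nth_eq_if_X_power_dvd by fastforce
  moreover have "fps_nth (F * J) N =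
      (\<Sum>k\<le>N. (-1) ^ k * of_nat (2 * k + 1) * of_nat (p2 (int N - int (triangular k))))"
  proof -
    \<comment> \<open>The value 0 of \<open>p2\<close> at negative arguments matches the
      coefficients lost on multiplying by q^(T_k).\<close>
    have F: "of_nat (p2 (int N - int (triangular k))) =
        (if N < triangular k then 0 else fps_nth F (N - triangular k))" for k
      by (auto simp: F_def num_colored_partitions_def nat_diff_distrib
          colored_partitions_eq_weighted_multisets[of _ N] simp flip: of_nat_diff)
    have c: "(-1) ^ k * of_nat (2 * k + 1)
        = (fps_const ((-1) ^ k * of_nat (2 * k + 1)) :: rat fps)" for k
      by (simp flip: fps_const_power fps_const_neg fps_const_1_eq_1 fps_of_nat fps_const_mult)
    have "fps_nth (F * J) N = (\<Sum>k\<le>N. fps_nth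
        (fps_const ((-1) ^ k * of_nat (2 * k + 1)) * (F * fps_X ^ triangular k)) N)"
      unfolding J_def c sum_distrib_left fps_sum_nth by (simp only: mult_ac)
    then show ?thesis
      by (simp only: fps_mult_left_const_nth fps_X_power_mult_right_nth F)
  qed
  ultimately have "of_int (\<Sum>k\<le>N. (-1) ^ k * (2 * int k + 1) * int (p2 (int N - int (triangular k))))
      = (of_int (\<Sum>j | pentagonal j = int N. (-1) ^ nat \<bar>j\<bar>) :: rat)"
    using fps_nth_qpoch[OF assms, where 'a=rat] by (simp add: algebra_simps)
  then show ?thesis
    by (simp only: of_int_eq_iff)
qed

theorem theorem1p1:
  fixes n :: int
  assumes "n > 0"
  shows "(\<forall>j. n = pentagonal j \<longrightarrow>
             int (p2 n) = (-1) ^ nat \<bar>j\<bar> + triangular_sum n) \<and>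
         ((\<nexists>j. n = pentagonal j) \<longrightarrow> int (p2 n) = triangular_sum n)"
proof -
  obtain N where N: "n = int N" "N > 0"
    using assms by (metis zero_less_imp_eq_int)
  have "{..N} = insert 0 {1..N}"
    by auto
  \<comment> \<open>The term k = 0 is \<open>p2 n\<close>; the others form the negated
    \<open>triangular_sum n\<close>.\<close>
  then have "int (p2 n) - triangular_sum n =
      (\<Sum>k\<le>N. (-1) ^ k * (2 * int k + 1) * int (p2 (int N - int (triangular k))))"
    unfolding N(1) triangular_sum_eq by (simp add: sum_negf)
  also have "\<dots> = (\<Sum>j | pentagonal j = n. (-1) ^ nat \<bar>j\<bar>)"
    using p2_convolution[OF N(2)] N(1) by simp
  finally have *: "int (p2 n) = (\<Sum>j | pentagonal j = n. (-1) ^ nat \<bar>j\<bar>) + triangular_sum n"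
    by simp
  show ?thesis
  proof (intro conjI allI impI)
    fix j
    assume "n = pentagonal j"
    then have "{i. pentagonal i = n} = {j}"
      using injD[OF inj_pentagonal] by auto
    then show "int (p2 n) = (-1) ^ nat \<bar>j\<bar> + triangular_sum n"
      unfolding * by simp
  next
    assume "\<nexists>j. n = pentagonal j"
    then have "{i. pentagonal i = n} = {}"
      by auto
    then show "int (p2 n) = triangular_sum n"
      unfolding * by (simp only: sum.empty add_0)
  qed
qed

end
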